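(* Fix a hash table $\ell$ and a validation point $(x_t^{\mathrm{te}},y_t)$, and let $u_\ell^t$ be the bucket-vote utility on the player set $[N]$ (the indices of the training points), with bucket $\mathcal{B}_\ell^t$, bucket size $M=|\mathcal{B}_\ell^t|$ and same-label count $M^{+}=|\{j\in\mathcal{B}_\ell^t : y_j=y_t\}|$. Let $H_M=\sum_{j=1}^{M}1/j$. For a training point $i\in[N]$ let $\phi^{\pm}(\ell,i,t)$ denote the Shapley value of $i$ under $u_\ell^t$, where the $+$ branch applies when $y_i=y_t$ and the $-$ branch applies when $y_i\neq y_t$. Then (within each branch, for members of the bucket) the value depends on the data only through $(M,M^{+},H_M)$. More precisely: 1. If $i\notin\mathcal{B}_\ell^t$, then $\phi^{\pm}(\ell,i,t)=0$. 2. If $i\in\mathcal{B}_\ell^t$ and $M=1$, then $\phi^{\pm}(\ell,i,t)=\mathbf{1}[y_i=y_t]$. 3. If $i\in\mathcal{B}_\ell^t$ and $M\ge 2$, then $$\phi^{\pm}(\ell,i,t)=\begin{cases}\dfrac{H_M}{M}-\dfrac{(M^{+}-1)(H_M-1)}{M(M-1)} & \text{if } y_i=y_t,\\[8pt] -\dfrac{M^{+}(H_M-1)}{M(M-1)} & \text{if } y_i\neq y_t.\end{cases}$$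
   Context: Training set $\{(x_j^{\mathrm{tr}},y_j)\}_{j\in[N]}$ with feature vectors in $\mathbb{R}^d$ and labels in a finite set of classes; validation points $(x_t^{\mathrm{te}},y_t)$ likewise. Each hash table $\ell$ assigns to every vector $x\in\mathbb{R}^d$ a bucket id $B_\ell(x)=(\mathrm{sign}\langle r_\ell^{(k)},x\rangle)_{k<K}\in\{0,1\}^{K}$, where the projection vectors $r_\ell^{(k)}\in\mathbb{R}^d$ (sampled from $\mathcal{N}(0,I_d)$) are fixed and $\mathrm{sign}$ takes values in $\{0,1\}$. Bucket: $\mathcal{B}_\ell^t=\{j\in[N] : B_\ell(x_j^{\mathrm{tr}})=B_\ell(x_t^{\mathrm{te}})\}$. Utility: for $S\subseteq[N]$, $u_\ell^t(S)=0$ if $S\cap\mathcal{B}_\ell^t=\emptyset$, and otherwise $$u_\ell^t(S)=\frac{|\{j\in S\cap\mathcal{B}_\ell^t : y_j=y_t\}|}{|S\cap\mathcal{B}_\ell^t|}.$$ Shapley value of player $i\in[N]$ under a utility $u:2^{[N]}\to\mathbb{R}$: $$\phi_i=\sum_{S\subseteq[N]\setminus\{i\}}\frac{|S|!\,(N-|S|-1)!}{N!}\bigl(u(S\cup\{i\})-u(S)\bigr).$$ *)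

theory Defs
  imports "HOL-Analysis.Analysis"
begin

text \<open>A \<open>{0,1}\<close>-valued sign function. Its value at \<open>0\<close> is a free convention.\<close>

definition is_sign_bit :: "(real \<Rightarrow> nat) \<Rightarrow> bool" where
  "is_sign_bit sg \<longleftrightarrow> (\<forall>z>0. sg z = 1) \<and> (\<forall>z<0. sg z = 0) \<and> sg 0 \<in> {0, 1}"

text \<open>\<open>\<rho> k\<close> is the \<open>k\<close>-th projection vector of one hash table; only \<open>k < K\<close> is used.\<close>

definition bucket_id :: "(real \<Rightarrow> nat) \<Rightarrow> nat \<Rightarrow> (nat \<Rightarrow> real ^ 'd) \<Rightarrow> real ^ 'd \<Rightarrow> nat list" where
  "bucket_id sg K \<rho> x = map (\<lambda>k. sg (\<rho> k \<bullet> x)) [0..<K]"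

text \<open>The training indices \<open>[N]\<close> are \<open>{1..N}\<close>. The argument \<open>h\<close> is the hash of the table.\<close>

definition bucket :: "nat \<Rightarrow> (real ^ 'd \<Rightarrow> nat list) \<Rightarrow> (nat \<Rightarrow> real ^ 'd) \<Rightarrow> real ^ 'd \<Rightarrow> nat set" where
  "bucket N h xtr x = {j \<in> {1..N}. h (xtr j) = h x}"

definition bucket_utility :: "nat set \<Rightarrow> (nat \<Rightarrow> 'c) \<Rightarrow> 'c \<Rightarrow> nat set \<Rightarrow> real" where
  "bucket_utility Bk ytr y S =
     (if S \<inter> Bk = {} then 0
      else real (card {j \<in> S \<inter> Bk. ytr j = y}) / real (card (S \<inter> Bk)))"

definition shapley :: "nat \<Rightarrow> (nat set \<Rightarrow> real) \<Rightarrow> nat \<Rightarrow> real" where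
  "shapley N u i =
     (\<Sum>S \<in> Pow ({1..N} - {i}).
        fact (card S) * fact (N - card S - 1) / fact N * (u (S \<union> {i}) - u S))"

end

theory Submission
  imports Defs
begin

text \<open>The bucket utility is a sum of games \<open>v\<^sub>j(S) = 1/|S|\<close> if \<open>j \<in> S\<close> and \<open>0\<close> otherwise, one for each
  same-label member \<open>j\<close> of the bucket, with \<open>S\<close> intersected with the bucket. Players outside the
  bucket are null, so the Shapley value may be computed on the bucket alone; there, grouping
  coalitions by size makes the value of \<open>i\<close> in \<open>v\<^sub>j\<close> equal \<open>H\<^sub>M/M\<close> if \<open>j = i\<close> and
  \<open>-(H\<^sub>M - 1)/(M(M - 1))\<close> otherwise.\<close>

section \<open>Shapley values over an arbitrary player set\<close>

text \<open>The player set is a parameter, so that null players can be removed from it one at a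
  time.\<close>

definition shapley_on :: "'a set \<Rightarrow> ('a set \<Rightarrow> real) \<Rightarrow> 'a \<Rightarrow> real" where
  "shapley_on P u i =
     (\<Sum>S \<in> Pow (P - {i}).
        fact (card S) * fact (card P - card S - 1) / fact (card P) * (u (insert i S) - u S))"

definition share_game :: "'a \<Rightarrow> 'a set \<Rightarrow> real" where
  "share_game j S = (if j \<in> S then 1 / real (card S) else 0)"

lemma shapley_eq_shapley_on: "shapley N u i = shapley_on {1..N} u i"
  by (simp add: shapley_def shapley_on_def)

text \<open>For \<open>i \<in> P\<close> both coalitions in a marginal contribution lie inside
  \<open>P\<close>. This later lets the intersection with the bucket be dropped, once the bucket is
  the player set.\<close>

lemma shapley_on_cong:
  assumes "i \<in> P" "\<And>S. S \<subseteq> P \<Longrightarrow> u S = v S"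
  shows "shapley_on P u i = shapley_on P v i"
  unfolding shapley_on_def
proof (rule sum.cong[OF refl])
  fix S assume "S \<in> Pow (P - {i})"
  then have "insert i S \<subseteq> P" "S \<subseteq> P"
    using assms(1) by auto
  then have "u (insert i S) = v (insert i S)" "u S = v S"
    by (simp_all add: assms(2))
  then show "fact (card S) * fact (card P - card S - 1) / fact (card P) * (u (insert i S) - u S)
    = fact (card S) * fact (card P - card S - 1) / fact (card P) * (v (insert i S) - v S)"
    by simp
qed

lemma shapley_on_sum:
  "shapley_on P (\<lambda>S. \<Sum>j\<in>J. v j S) i = (\<Sum>j\<in>J. shapley_on P (v j) i)"
  unfolding shapley_on_def
  by (subst sum.swap) (simp add: sum_subtractf[symmetric] sum_distrib_left)

lemma shapley_on_null: "(\<And>S. u (insert i S) = u S) \<Longrightarrow> shapley_on P u i = 0"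
  by (simp add: shapley_on_def)

section \<open>Sums over coalitions\<close>

lemma sum_Pow_insert:
  assumes "finite A" "k \<notin> A"
  shows "(\<Sum>S\<in>Pow (insert k A). f S) = (\<Sum>S\<in>Pow A. f S + f (insert k S))"
proof -
  have "inj_on (insert k) (Pow A)"
    using assms by (auto simp: inj_on_def)
  moreover have "Pow A \<inter> insert k ` Pow A = {}"
    using assms by auto
  ultimately show ?thesis
    using assms by (simp add: Pow_insert sum.union_disjoint sum.reindex sum.distrib)
qed

text \<open>Group the subsets by size; the binomial coefficient counts each group.\<close>

lemma sum_Pow_card:
  fixes f :: "nat \<Rightarrow> real"
  assumes "finite A"
  shows "(\<Sum>S\<in>Pow A. f (card S)) = (\<Sum>s\<le>card A. real (card A choose s) * f s)"
proof -
  have "(\<Sum>S\<in>Pow A. f (card S)) = (\<Sum>s\<le>card A. \<Sum>S\<in>{S \<in> Pow A. card S = s}. f (card S))"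
    using assms by (subst sum.group) (auto simp: card_mono)
  also have "\<dots> = (\<Sum>s\<le>card A. real (card A choose s) * f s)"
    using assms by (intro sum.cong) (auto simp: n_subsets)
  finally show ?thesis .
qed

section \<open>Removal of null players\<close>

text \<open>Weights are probabilities that a given coalition is exactly the set of players before
  \<open>i\<close> in a random order. A new player in the order comes either after \<open>i\<close>,
  which keeps the size \<open>s\<close>, or before \<open>i\<close>, which makes it
  \<open>s + 1\<close>. With \<open>n = s + m + 1\<close> the numerators add up to
  \<open>s! m! (n + 1)\<close>.\<close>

lemma shapley_weight_split:
  assumes "s < n"
  shows "fact s * fact (Suc n - s - 1) / fact (Suc n)
       + fact (Suc s) * fact (Suc n - Suc s - 1) / fact (Suc n)
       = (fact s * fact (n - s - 1) / fact n :: real)"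
proof -
  obtain m where n: "n = Suc (s + m)"
    using assms less_imp_Suc_add by blast
  have "fact s * fact (Suc m) + fact (Suc s) * fact m = fact s * fact m * (real n + 1)"
    by (simp add: n algebra_simps)
  moreover have "fact (Suc n) = (real n + 1) * fact n"
    by simp
  ultimately have "fact s * fact (Suc m) / fact (Suc n) + fact (Suc s) * fact m / fact (Suc n)
      = fact s * fact m * (real n + 1) / ((real n + 1) * fact n)"
    by (metis add_divide_distrib)
  also have "\<dots> = fact s * fact m / fact n"
    by simp
  finally show ?thesis
    by (simp add: n del: fact_Suc)
qed

text \<open>The coalitions \<open>S\<close> and \<open>insert k S\<close> give \<open>i\<close> the
  same marginal contribution, and their two weights merge into the weight of \<open>S\<close> for
  the player set \<open>P\<close>.\<close>

lemma shapley_on_insert_null: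
  assumes "finite P" "i \<in> P" "k \<notin> P" "\<And>S. u (insert k S) = u S"
  shows "shapley_on (insert k P) u i = shapley_on P u i"
proof -
  let ?w = "\<lambda>n s. fact s * fact (n - s - 1) / fact n :: real"
  have "shapley_on (insert k P) u i
      = (\<Sum>S\<in>Pow (insert k (P - {i})). ?w (Suc (card P)) (card S) * (u (insert i S) - u S))"
    using assms by (auto simp: shapley_on_def insert_Diff_if)
  also have "\<dots> = (\<Sum>S\<in>Pow (P - {i}). ?w (Suc (card P)) (card S) * (u (insert i S) - u S)
      + ?w (Suc (card P)) (card (insert k S)) * (u (insert i (insert k S)) - u (insert k S)))"
    using assms by (intro sum_Pow_insert) auto
  also have "\<dots> = shapley_on P u i"
    unfolding shapley_on_def
  proof (rule sum.cong[OF refl])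
    fix S assume S: "S \<in> Pow (P - {i})"
    then have "finite S" "k \<notin> S" "S \<subset> P"
      using assms by (auto intro: finite_subset)
    \<comment> \<open>The inclusion in \<open>P\<close> is proper because \<open>S\<close> misses
      \<open>i\<close>; this is the bound that the weight identity requires.\<close>
    then have c: "card (insert k S) = Suc (card S)" and lt: "card S < card P"
      using assms by (auto intro: psubset_card_mono)
    have "u (insert i (insert k S)) = u (insert i S)"
      using assms(4)[of "insert i S"] by (simp add: insert_commute)
    then show "?w (Suc (card P)) (card S) * (u (insert i S) - u S)
      + ?w (Suc (card P)) (card (insert k S)) * (u (insert i (insert k S)) - u (insert k S))
      = ?w (card P) (card S) * (u (insert i S) - u S)"
      unfolding c assms(4) shapley_weight_split[OF lt, symmetric] by (simp add: distrib_right)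
  qed
  finally show ?thesis .
qed

text \<open>Induction on the set \<open>D\<close> of players outside \<open>B\<close>, discarding
  one null player at each step.\<close>

lemma shapley_on_carrier:
  assumes "finite P" "B \<subseteq> P" "i \<in> B" "\<And>S k. k \<notin> B \<Longrightarrow> u (insert k S) = u S"
  shows "shapley_on P u i = shapley_on B u i"
proof -
  have "shapley_on (D \<union> B) u i = shapley_on B u i" if "finite D" "D \<inter> B = {}" for D
    using that
  proof (induction D)
    case (insert k D)
    have "finite (D \<union> B)"
      using insert assms finite_subset by auto
    then show ?case
      using insert assms shapley_on_insert_null[of "D \<union> B" i k u] by auto
  qed simp
  from this[of "P - B"] show ?thesis
    using assms by (auto simp: Un_absorb1 Un_absorb2 Diff_partition)
qed

section \<open>Values of the share games\<close>

text \<open>The sum runs from \<open>1/2\<close> to \<open>1/(n + 1)\<close>, so it is a harmonic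
  number without its first term. This is the source of \<open>H - 1\<close> in the result.\<close>

lemma harm_shift: "(\<Sum>t<n. 1 / (real t + 2)) = harm (Suc n) - (1::real)"
proof (induction n)
  case (Suc n)
  then show ?case
    by (simp add: harm_Suc[of "Suc n"] inverse_eq_divide add.commute)
qed (simp add: harm_expand)

text \<open>A coalition of size \<open>s\<close> without \<open>i\<close> is worth 0, and
  \<open>1/(s + 1)\<close> once \<open>i\<close> joins. All coalitions of one size together have
  weight \<open>1/M\<close>, where \<open>M = card B\<close>, so the value is the average of
  \<open>1/(s + 1)\<close> over \<open>s < M\<close>.\<close>

lemma shapley_on_share_game_self:
  assumes "finite B" "i \<in> B"
  shows "shapley_on B (share_game i) i = harm (card B) / real (card B)"
proof -
  define n where "n = card (B - {i})"
  have cB: "card B = Suc n"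
    using assms by (metis card_Suc_Diff1 n_def)
  have "shapley_on B (share_game i) i
      = (\<Sum>S\<in>Pow (B - {i}). fact (card S) * fact (n - card S) / fact (Suc n) * (1 / (real (card S) + 1)))"
    unfolding shapley_on_def
  proof (rule sum.cong[OF refl])
    fix S assume "S \<in> Pow (B - {i})"
    then have "finite S" "i \<notin> S"
      using assms by (auto intro: finite_subset)
    then show "fact (card S) * fact (card B - card S - 1) / fact (card B) *
        (share_game i (insert i S) - share_game i S)
      = fact (card S) * fact (n - card S) / fact (Suc n) * (1 / (real (card S) + 1))"
      by (simp add: share_game_def cB add.commute)
  qed
  also have "\<dots> = (\<Sum>s\<le>n. real (n choose s)
      * (fact s * fact (n - s) / fact (Suc n) * (1 / (real s + 1))))"
    unfolding n_def using assms by (intro sum_Pow_card) auto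
  \<comment> \<open>The number of coalitions of size \<open>s\<close> cancels against their weight,
    leaving \<open>n!/(n + 1)!\<close>.\<close>
  also have "\<dots> = (\<Sum>s\<le>n. inverse (real (Suc s)) / real (Suc n))"
  proof (rule sum.cong[OF refl])
    fix s assume "s \<in> {..n}"
    then have "real (n choose s) * (fact s * fact (n - s)) = fact n"
      by (simp add: binomial_fact)
    then have "real (n choose s) * (fact s * fact (n - s) / fact (Suc n) * (1 / (real s + 1)))
      = fact n / fact (Suc n) * (1 / (real s + 1))"
      by (metis times_divide_eq_right mult.assoc times_divide_eq_left)
    also have "fact n / fact (Suc n) = 1 / real (Suc n)"
      by (simp add: divide_simps)
    finally show "real (n choose s) * (fact s * fact (n - s) / fact (Suc n) * (1 / (real s + 1)))
      = inverse (real (Suc s)) / real (Suc n)"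
      by (simp add: inverse_eq_divide mult.commute add.commute)
  qed
  also have "\<dots> = harm (card B) / real (card B)"
    unfolding cB harm_def sum_divide_distrib[symmetric]
    by (simp only: lessThan_Suc_atMost[symmetric] sum.atLeast1_atMost_eq One_nat_def)
  finally show ?thesis .
qed

text \<open>Only coalitions containing \<open>j\<close> count. If such a coalition has
  \<open>s\<close> further members, the arrival of \<open>i\<close> dilutes the share of
  \<open>j\<close> from \<open>1/(s + 1)\<close> to \<open>1/(s + 2)\<close>. Weighted and summed
  over \<open>s\<close>, these losses give a shifted harmonic sum.\<close>

lemma shapley_on_share_game_other:
  assumes "finite B" "i \<in> B" "j \<in> B" "j \<noteq> i"
  shows "shapley_on B (share_game j) i
       = - ((harm (card B) - 1) / (real (card B) * (real (card B) - 1)))"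
proof -
  define A where "A = B - {i} - {j}"
  define n where "n = card A"
  have A: "finite A" "i \<notin> A" "j \<notin> A" and B: "B - {i} = insert j A"
    using assms by (auto simp: A_def)
  have cB: "card B = Suc (Suc n)"
    using assms A B by (metis card_Suc_Diff1 card_insert_disjoint n_def)
  have "shapley_on B (share_game j) i
      = (\<Sum>S\<in>Pow A. fact (Suc (card S)) * fact (n - card S) / fact (Suc (Suc n)) *
          (1 / (real (card S) + 2) - 1 / (real (card S) + 1)))"
    unfolding shapley_on_def B sum_Pow_insert[OF A(1) A(3)]
  proof (rule sum.cong[OF refl])
    fix S assume "S \<in> Pow A"
    then have "finite S" "i \<notin> S" "j \<notin> S"
      using A by (auto intro: finite_subset)
    \<comment> \<open>The first summand vanishes because \<open>j\<close> is absent. In the second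
      the coalition has size \<open>s + 1\<close>, and \<open>card B = n + 2\<close> leaves
      \<open>n - s\<close> players after \<open>i\<close>.\<close>
    then show "fact (card S) * fact (card B - card S - 1) / fact (card B) *
        (share_game j (insert i S) - share_game j S) +
        fact (card (insert j S)) * fact (card B - card (insert j S) - 1) / fact (card B) *
        (share_game j (insert i (insert j S)) - share_game j (insert j S))
      = fact (Suc (card S)) * fact (n - card S) / fact (Suc (Suc n)) *
          (1 / (real (card S) + 2) - 1 / (real (card S) + 1))"
      using assms(4) by (simp add: share_game_def cB add.commute del: fact_Suc)
  qed
  also have "\<dots> = (\<Sum>s\<le>n. real (n choose s) * (fact (Suc s) * fact (n - s) / fact (Suc (Suc n)) *
      (1 / (real s + 2) - 1 / (real s + 1))))"
    unfolding n_def using A by (intro sum_Pow_card) auto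
  also have "\<dots> = (\<Sum>s\<le>n. - (1 / (real s + 2)) / (real (Suc (Suc n)) * real (Suc n)))"
  proof (rule sum.cong[OF refl])
    fix s assume "s \<in> {..n}"
    then have *: "real (n choose s) * (fact s * fact (n - s)) = fact n"
      by (simp add: binomial_fact)
    \<comment> \<open>Splitting the factor \<open>s + 1\<close> off \<open>fact (Suc s)\<close> lets
      the binomial coefficient cancel; that factor then cancels the denominator of the loss
      \<open>1/((s + 1)(s + 2))\<close>.\<close>
    have "real (n choose s) * (fact (Suc s) * fact (n - s) / fact (Suc (Suc n)) *
        (1 / (real s + 2) - 1 / (real s + 1)))
      = real (n choose s) * (fact s * fact (n - s)) * (real (Suc s) / fact (Suc (Suc n)) *
        (1 / (real s + 2) - 1 / (real s + 1)))"
      by simp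
    also have "\<dots> = fact n / fact (Suc (Suc n)) *
        (real (Suc s) * (1 / (real s + 2) - 1 / (real s + 1)))"
      unfolding * by simp
    also have "real (Suc s) * (1 / (real s + 2) - 1 / (real s + 1)) = - (1 / (real s + 2))"
      by (simp add: divide_simps)
    also have "fact n / fact (Suc (Suc n)) = 1 / (real (Suc (Suc n)) * real (Suc n))"
      by (simp add: divide_simps)
    finally show "real (n choose s) * (fact (Suc s) * fact (n - s) / fact (Suc (Suc n)) *
        (1 / (real s + 2) - 1 / (real s + 1)))
      = - (1 / (real s + 2)) / (real (Suc (Suc n)) * real (Suc n))"
      by simp
  qed
  also have "\<dots> = - ((\<Sum>s<Suc n. 1 / (real s + 2)) / (real (Suc (Suc n)) * real (Suc n)))"
    by (simp only: sum_divide_distrib[symmetric] sum_negf minus_divide_left[symmetric] lessThan_Suc_atMost)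
  finally show ?thesis
    by (simp add: harm_shift cB)
qed

section \<open>The bucket utility\<close>

text \<open>Each same-label member of \<open>S \<inter> B\<close> contributes one share of the vote,
  and indices outside \<open>S\<close> contribute 0. An empty intersection gives an empty sum, in
  agreement with the default value of the utility.\<close>

lemma bucket_utility_eq_sum_share_game:
  assumes "finite B"
  shows "bucket_utility B ytr y S = (\<Sum>j\<in>{j \<in> B. ytr j = y}. share_game j (S \<inter> B))"
proof -
  have "(\<Sum>j\<in>{j \<in> B. ytr j = y}. share_game j (S \<inter> B))
      = (\<Sum>j\<in>{j \<in> S \<inter> B. ytr j = y}. 1 / real (card (S \<inter> B)))"
    using assms by (intro sum.mono_neutral_cong_right) (auto simp: share_game_def)
  then show ?thesis
    by (auto simp: bucket_utility_def)
qed

text \<open>Points outside the bucket are thus null players: their own value is 0, and they may be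
  removed when the value of a bucket member is computed.\<close>

lemma bucket_utility_insert_outside:
  "k \<notin> B \<Longrightarrow> bucket_utility B ytr y (insert k S) = bucket_utility B ytr y S"
  by (simp add: bucket_utility_def)

lemma shapley_bucket_utility:
  assumes "B \<subseteq> {1..N}" "i \<in> B"
  shows "shapley N (bucket_utility B ytr y) i =
     (if ytr i = y
      then harm (card B) / real (card B)
        - (real (card {j \<in> B. ytr j = y}) - 1) * (harm (card B) - 1)
          / (real (card B) * (real (card B) - 1))
      else - (real (card {j \<in> B. ytr j = y}) * (harm (card B) - 1)
          / (real (card B) * (real (card B) - 1))))"
proof -
  let ?J = "{j \<in> B. ytr j = y}"
  \<comment> \<open>The loss of \<open>i\<close> in the game of another member. For a singleton
    bucket it is 0, as division by 0 yields 0.\<close>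
  define c where "c = (harm (card B) - 1) / (real (card B) * (real (card B) - 1))"
  have fin: "finite B"
    using assms finite_subset by blast
  have "shapley N (bucket_utility B ytr y) i = shapley_on B (bucket_utility B ytr y) i"
    unfolding shapley_eq_shapley_on
    using assms by (intro shapley_on_carrier bucket_utility_insert_outside) auto
  also have "\<dots> = shapley_on B (\<lambda>S. \<Sum>j\<in>?J. share_game j S) i"
    using assms fin by (intro shapley_on_cong) (simp_all add: bucket_utility_eq_sum_share_game Int_absorb2)
  also have "\<dots> = (\<Sum>j\<in>?J. shapley_on B (share_game j) i)"
    by (rule shapley_on_sum)
  also have "\<dots> = (\<Sum>j\<in>?J. if j = i then harm (card B) / real (card B) else - c)"
    using assms fin
    by (intro sum.cong) (auto simp: shapley_on_share_game_self shapley_on_share_game_other c_def)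
  \<comment> \<open>With matching labels \<open>i\<close> is itself an index of the sum, which
    leaves \<open>card ?J - 1\<close> games of others; otherwise every index is another
    player.\<close>
  also have "\<dots> = (if ytr i = y then harm (card B) / real (card B) - (real (card ?J) - 1) * c
      else - (real (card ?J) * c))"
  proof (cases "ytr i = y")
    case True
    then have "i \<in> ?J" "finite ?J"
      using assms fin by auto
    moreover from this have "real (card (?J - {i})) = real (card ?J) - 1"
      by (metis card_Suc_Diff1 of_nat_Suc add_diff_cancel_left')
    ultimately show ?thesis
      using True by (simp add: sum.remove[of ?J i])
  next
    case False
    then have "(\<Sum>j\<in>?J. if j = i then harm (card B) / real (card B) else - c) = (\<Sum>j\<in>?J. - c)"
      by (intro sum.cong) auto
    then show ?thesis
      using False by simp
  qed
  finally show ?thesis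
    by (simp add: c_def)
qed

theorem theorem4p1:
  shows "\<exists>Fplus Fminus :: nat \<Rightarrow> nat \<Rightarrow> real \<Rightarrow> real.
    \<forall>(sg :: real \<Rightarrow> nat) (K :: nat) (r :: nat \<Rightarrow> nat \<Rightarrow> real ^ 'd) (N :: nat)
      (xtr :: nat \<Rightarrow> real ^ 'd) (ytr :: nat \<Rightarrow> 'c :: finite)
      (xte :: nat \<Rightarrow> real ^ 'd) (yte :: nat \<Rightarrow> 'c) (l :: nat) (t :: nat) (i :: nat).
      is_sign_bit sg \<longrightarrow> i \<in> {1..N} \<longrightarrow>
      (let Bk = bucket N (bucket_id sg K (r l)) xtr (xte t);
           M = card Bk;
           Mp = card {j \<in> Bk. ytr j = yte t};
           H = (harm M :: real);
           \<phi> = shapley N (bucket_utility Bk ytr (yte t)) i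
       in (i \<in> Bk \<longrightarrow> \<phi> = (if ytr i = yte t then Fplus M Mp H else Fminus M Mp H)) \<and>
          (i \<notin> Bk \<longrightarrow> \<phi> = 0) \<and>
          (i \<in> Bk \<and> M = 1 \<longrightarrow> \<phi> = (if ytr i = yte t then 1 else 0)) \<and>
          (i \<in> Bk \<and> M \<ge> 2 \<longrightarrow>
             \<phi> = (if ytr i = yte t
                  then H / real M - (real Mp - 1) * (H - 1) / (real M * (real M - 1))
                  else - (real Mp * (H - 1) / (real M * (real M - 1))))))"
proof -
  \<comment> \<open>The closed forms themselves are the witnesses. Being chosen before the data,
    they express that the value depends only on \<open>M\<close>, \<open>Mp\<close> and
    \<open>H\<close>.\<close>
  let ?Fp = "\<lambda>M Mp H. H / real M - (real Mp - 1) * (H - 1) / (real M * (real M - 1))"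
  let ?Fm = "\<lambda>M Mp H. - (real Mp * (H - 1) / (real M * (real M - 1)))"
  show ?thesis
  proof (rule exI[of _ ?Fp], rule exI[of _ ?Fm], intro allI impI, unfold Let_def, intro conjI impI)
    fix sg :: "real \<Rightarrow> nat" and K N l t i :: nat and r :: "nat \<Rightarrow> nat \<Rightarrow> real ^ 'd"
      and xtr xte :: "nat \<Rightarrow> real ^ 'd" and ytr yte :: "nat \<Rightarrow> 'c"
    let ?B = "bucket N (bucket_id sg K (r l)) xtr (xte t)"
    let ?v = "shapley N (bucket_utility ?B ytr (yte t)) i"
    have sub: "?B \<subseteq> {1..N}"
      by (auto simp: bucket_def)
    note val = shapley_bucket_utility[OF sub, of i ytr "yte t"]
    show "?v = 0" if "i \<notin> ?B"
      unfolding shapley_eq_shapley_on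
      using that by (intro shapley_on_null bucket_utility_insert_outside)
    show "?v = (if ytr i = yte t
        then ?Fp (card ?B) (card {j \<in> ?B. ytr j = yte t}) (harm (card ?B))
        else ?Fm (card ?B) (card {j \<in> ?B. ytr j = yte t}) (harm (card ?B)))" if "i \<in> ?B"
      using val that by simp
    show "?v = (if ytr i = yte t
        then ?Fp (card ?B) (card {j \<in> ?B. ytr j = yte t}) (harm (card ?B))
        else ?Fm (card ?B) (card {j \<in> ?B. ytr j = yte t}) (harm (card ?B)))"
      if "i \<in> ?B \<and> 2 \<le> card ?B"
      using val that by simp
    \<comment> \<open>At \<open>M = 1\<close> the general formula still applies: its quotients by \<open>M - 1 = 0\<close> are \<open>0\<close>.\<close>
    show "?v = (if ytr i = yte t then 1 else 0)" if "i \<in> ?B \<and> card ?B = 1"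
      using val that by (simp add: harm_expand)
  qed
qed

end
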